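(* Let $0\le m<3$ and $\alpha\in(-\tfrac43 m,\infty)$. Let $u$ be a non-negative entire viscosity solution of $$\Delta_\infty u(x)=|x|^\alpha u^m(x)\quad\text{in }\mathbb{R}^n$$ with $u(0)=0$. Suppose that $$\lim_{|x|\to\infty}\frac{u(x)}{|x|^{\frac{4+\alpha}{3-m}}}=0.$$ Then $u\equiv0$.
   Context: $n\ge2$. The infinity-Laplacian is $\Delta_\infty u=\sum_{i,j=1}^n\partial_iu\,\partial_{ij}u\,\partial_ju=(Du)^TD^2u\,Du$. "Entire" means defined on all of $\mathbb{R}^n$. Viscosity solutions: a continuous function $u$ is a viscosity sub-solution (resp. super-solution) of $\Delta_\infty u=F(x,u)$ if, whenever $\varphi$ is $C^2$ and $u-\varphi$ has a local maximum (resp. minimum) at a point $y$, then $\Delta_\infty\varphi(y)\ge F(y,u(y))$ (resp. $\le$). A viscosity solution is both. *)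

theory Defs
  imports "HOL-Analysis.Analysis"
begin

definition partial_derivative :: "'n::finite \<Rightarrow> (real^'n \<Rightarrow> real) \<Rightarrow> real^'n \<Rightarrow> real" where
  "partial_derivative i f x = frechet_derivative f (at x) (axis i 1)"

text \<open>The differentiability clauses are needed because \<^const>\<open>frechet_derivative\<close> is unspecified at
  points where the function is not differentiable. Continuity of the first-order partial
  derivatives follows from their differentiability.\<close>

definition C2 :: "(real^'n::finite \<Rightarrow> real) \<Rightarrow> bool" where
  "C2 f \<longleftrightarrow>
     (\<forall>x. f differentiable (at x)) \<and>
     (\<forall>i x. partial_derivative i f differentiable (at x)) \<and>
     (\<forall>i j. continuous_on UNIV (partial_derivative i (partial_derivative j f)))"

definition infinity_laplacian :: "(real^'n::finite \<Rightarrow> real) \<Rightarrow> real^'n \<Rightarrow> real" where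
  "infinity_laplacian f x =
     (\<Sum>i\<in>UNIV. \<Sum>j\<in>UNIV. partial_derivative i f x
        * partial_derivative i (partial_derivative j f) x * partial_derivative j f x)"

definition viscosity_subsolution ::
    "(real^'n::finite \<Rightarrow> real \<Rightarrow> real) \<Rightarrow> (real^'n \<Rightarrow> real) \<Rightarrow> bool" where
  "viscosity_subsolution F u \<longleftrightarrow> continuous_on UNIV u \<and>
     (\<forall>\<phi> y. C2 \<phi> \<longrightarrow> (\<forall>\<^sub>F x in nhds y. u x - \<phi> x \<le> u y - \<phi> y) \<longrightarrow>
        infinity_laplacian \<phi> y \<ge> F y (u y))"

definition viscosity_supersolution ::
    "(real^'n::finite \<Rightarrow> real \<Rightarrow> real) \<Rightarrow> (real^'n \<Rightarrow> real) \<Rightarrow> bool" where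
  "viscosity_supersolution F u \<longleftrightarrow> continuous_on UNIV u \<and>
     (\<forall>\<phi> y. C2 \<phi> \<longrightarrow> (\<forall>\<^sub>F x in nhds y. u x - \<phi> x \<ge> u y - \<phi> y) \<longrightarrow>
        infinity_laplacian \<phi> y \<le> F y (u y))"

definition viscosity_solution ::
    "(real^'n::finite \<Rightarrow> real \<Rightarrow> real) \<Rightarrow> (real^'n \<Rightarrow> real) \<Rightarrow> bool" where
  "viscosity_solution F u \<longleftrightarrow> viscosity_subsolution F u \<and> viscosity_supersolution F u"

text \<open>Real powers of non-negative reals with the convention that the zeroth power is constantly 1;
  the library has \<open>0 powr 0 = 0\<close>.\<close>

definition real_power :: "real \<Rightarrow> real \<Rightarrow> real" where
  "real_power t a = (if a = 0 then 1 else t powr a)"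

text \<open>For \<open>\<alpha> < 0\<close> the weight is singular at the origin, where \<^const>\<open>real_power\<close> takes the value 0.
  If \<open>\<alpha> > - 4 * m / 3\<close>, this case requires \<open>m > 0\<close>, so \<open>henon_rhs \<alpha> m 0 0 = 0\<close> whatever value
  the weight is given at the origin.\<close>

definition henon_rhs :: "real \<Rightarrow> real \<Rightarrow> real^'n::finite \<Rightarrow> real \<Rightarrow> real" where
  "henon_rhs \<alpha> m x t = real_power (norm x) \<alpha> * real_power t m"

end

theory Submission imports Defs begin

text \<open>
  Put \<open>\<beta> = (4 + \<alpha>) / (3 - m)\<close>. The radial function \<open>\<epsilon> \<bar>x\<bar>\<^sup>\<beta>\<close> has the scaling of the equation:
  \<open>\<Delta>\<^sub>\<infinity>(\<epsilon> \<bar>x\<bar>\<^sup>\<beta>)\<close> is \<open>\<epsilon>\<^sup>3 \<bar>x\<bar> powr (3 * \<beta> - 4)\<close> up to a constant factor, while the right-hand side at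
  \<open>\<epsilon> \<bar>x\<bar>\<^sup>\<beta>\<close> is \<open>\<epsilon>\<^sup>m \<bar>x\<bar> powr (\<alpha> + m * \<beta>)\<close>, and the two powers of \<open>\<bar>x\<bar>\<close> agree. Since \<open>m < 3\<close>, the
  radial function is a strict super-solution away from the origin for all small \<open>\<epsilon> > 0\<close>. It vanishes
  at the origin, as \<open>u\<close> does, and it dominates \<open>u\<close> near infinity by the growth hypothesis. If it failed
  to dominate \<open>u\<close> everywhere, the difference \<open>u - \<epsilon> \<bar>x\<bar>\<^sup>\<beta>\<close> would attain a positive maximum at some
  \<open>y \<noteq> 0\<close>, where the sub-solution property contradicts the strict super-solution property. Hence
  \<open>u x \<le> \<epsilon> \<bar>x\<bar>\<^sup>\<beta>\<close> for all small \<open>\<epsilon>\<close>, and letting \<open>\<epsilon>\<close> tend to zero gives \<open>u = 0\<close>.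

  Test functions have to be \<open>C\<^sup>2\<close> on the whole space, and \<open>\<bar>x\<bar>\<^sup>\<beta>\<close> may fail to be so at the origin.
  It is therefore replaced by a polynomial \<open>a + b * \<bar>x\<bar> ^ (2 * k + 4)\<close> with \<open>\<beta> \<le> 2 * k + 4\<close>, which
  touches it from above along the sphere through \<open>y\<close> (\<open>powr_le_touching_monomial\<close>). Its infinity-Laplacian
  at \<open>y\<close> may be larger than that of the power, but only by a factor depending on \<open>\<beta>\<close> and \<open>k\<close>, which
  is absorbed in the smallness of \<open>\<epsilon>\<close>.
\<close>

section \<open>Even powers of the norm as test functions\<close>

lemma has_derivative_inner_self_power:
  fixes x :: "'a::real_inner"
  shows "((\<lambda>x. (x \<bullet> x) ^ Suc n) has_derivative
           (\<lambda>h. real (Suc n) * (x \<bullet> x) ^ n * (2 * (x \<bullet> h)))) (at x)"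
proof -
  have "((\<lambda>x. x \<bullet> x) has_derivative (\<lambda>h. 2 * (x \<bullet> h))) (at x)"
    by (auto intro!: derivative_eq_intros simp: inner_commute)
  from has_derivative_power[OF this, of "Suc n"] show ?thesis
    by (simp add: mult_ac del: power_Suc of_nat_Suc)
qed

lemma partial_derivative_eq:
  assumes "(f has_derivative f') (at x)"
  shows "partial_derivative i f x = f' (axis i 1)"
  unfolding partial_derivative_def using frechet_derivative_at[OF assms] by metis

lemma has_derivative_even_norm_power:
  fixes x :: "real^'n::finite"
  shows "((\<lambda>x. a + b * (x \<bullet> x) ^ Suc n) has_derivative
           (\<lambda>h. b * (real (Suc n) * (x \<bullet> x) ^ n * (2 * (x \<bullet> h))))) (at x)"
  by (rule derivative_eq_intros has_derivative_inner_self_power refl | simp)+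

lemma partial_derivative_even_norm_power:
  fixes x :: "real^'n::finite"
  shows "partial_derivative i (\<lambda>x. a + b * (x \<bullet> x) ^ Suc n) x
           = 2 * b * real (Suc n) * ((x \<bullet> x) ^ n * x $ i)"
  by (subst partial_derivative_eq[OF has_derivative_even_norm_power]) (simp add: inner_axis)

lemma has_derivative_even_norm_power_times_coordinate:
  fixes x :: "real^'n::finite"
  shows "((\<lambda>x. c * ((x \<bullet> x) ^ Suc n * x $ j)) has_derivative
           (\<lambda>h. c * ((x \<bullet> x) ^ Suc n * h $ j
                     + real (Suc n) * (x \<bullet> x) ^ n * (2 * (x \<bullet> h)) * x $ j))) (at x)"
  by (rule has_derivative_mult_right has_derivative_mult has_derivative_inner_self_power
        bounded_linear_imp_has_derivative bounded_linear_vec_nth)+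

lemma partial_derivative_even_norm_power_times_coordinate:
  fixes x :: "real^'n::finite"
  shows "partial_derivative i (\<lambda>x. c * ((x \<bullet> x) ^ Suc n * x $ j)) x
           = c * ((x \<bullet> x) ^ Suc n * (if i = j then 1 else 0)
                  + 2 * real (Suc n) * (x \<bullet> x) ^ n * (x $ i * x $ j))"
proof -
  have "axis i (1::real) $ j = (if i = j then 1 else 0)"
    by (simp add: axis_def)
  then show ?thesis
    by (subst partial_derivative_eq[OF has_derivative_even_norm_power_times_coordinate])
       (simp add: inner_axis algebra_simps)
qed

lemma C2_even_norm_power:
  "C2 (\<lambda>x::real^'n::finite. a + b * (x \<bullet> x) ^ Suc (Suc k))"
  unfolding C2_def partial_derivative_even_norm_power[abs_def]
    partial_derivative_even_norm_power_times_coordinate[abs_def]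
  using differentiableI[OF has_derivative_even_norm_power]
    differentiableI[OF has_derivative_even_norm_power_times_coordinate]
  by (intro conjI allI continuous_intros) blast+

text \<open>
  For a radial function \<open>f(\<bar>x\<bar>)\<close> the infinity-Laplacian is \<open>(f')\<^sup>2 f''\<close>; the exponent below is half of
  \<open>2 * (2 * k + 3) + (2 * k + 2)\<close>.
\<close>

lemma infinity_laplacian_even_norm_power:
  fixes x :: "real^'n::finite"
  shows "infinity_laplacian (\<lambda>x. a + b * (x \<bullet> x) ^ Suc (Suc k)) x
           = (2 * b * real (k + 2)) ^ 3 * real (2 * k + 3) * (x \<bullet> x) ^ (3 * k + 4)"
proof -
  define c where "c = 2 * b * real (k + 2)"
  define s where "s = x \<bullet> x"
  have s: "(\<Sum>i\<in>UNIV. x $ i * x $ i) = s"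
    unfolding s_def inner_vec_def by simp
  have "infinity_laplacian (\<lambda>x. a + b * (x \<bullet> x) ^ Suc (Suc k)) x
      = (\<Sum>i\<in>UNIV. \<Sum>j\<in>UNIV. c * (s ^ Suc k * x $ i)
           * (c * (s ^ Suc k * (if i = j then 1 else 0)
                   + 2 * real (Suc k) * s ^ k * (x $ i * x $ j)))
           * (c * (s ^ Suc k * x $ j)))"
    unfolding infinity_laplacian_def partial_derivative_even_norm_power[abs_def]
      partial_derivative_even_norm_power_times_coordinate c_def s_def
    by simp
  also have "\<dots> = (\<Sum>i\<in>UNIV. \<Sum>j\<in>UNIV.
        (if i = j then c ^ 3 * s ^ (3 * Suc k) * (x $ i * x $ j) else 0)
        + c ^ 3 * 2 * real (Suc k) * s ^ (3 * k + 2) * ((x $ i * x $ i) * (x $ j * x $ j)))"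
    by (intro sum.cong refl)
       (auto simp: algebra_simps power_add power2_eq_square power3_eq_cube power_mult)
  also have "\<dots> = c ^ 3 * s ^ (3 * Suc k) * s + c ^ 3 * 2 * real (Suc k) * s ^ (3 * k + 2) * (s * s)"
    by (simp add: sum.distrib sum_distrib_left[symmetric] sum_distrib_right[symmetric] s
        del: of_nat_Suc)
  also have "\<dots> = c ^ 3 * real (2 * k + 3) * s ^ (3 * k + 4)"
    by (simp add: algebra_simps power_add power2_eq_square power3_eq_cube eval_nat_numeral)
  finally show ?thesis
    unfolding c_def s_def .
qed

section \<open>Powers of the norm as strict super-solutions\<close>

text \<open>
  In the variable \<open>t = (r / R) ^ M\<close> the left-hand side is a concave power of \<open>t\<close>, up to the factor
  \<open>R powr \<beta>\<close>, and the right-hand side is its tangent at \<open>t = 1\<close>.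
\<close>

lemma powr_le_touching_monomial:
  fixes r R \<beta> :: real
  assumes "0 < \<beta>" "\<beta> \<le> real M" "0 < R" "0 \<le> r"
  shows "r powr \<beta> \<le> R powr \<beta> * ((1 - \<beta> / M) + \<beta> / M * (r / R) ^ M)"
proof (cases "r = 0")
  case True
  have "M > 0" using assms by (cases M) auto
  then show ?thesis using assms True by (simp add: power_0_left field_simps)
next
  case False
  have M: "real M > 0" using assms by linarith
  have pos: "0 < r / R" using False assms by simp
  have "((r / R) ^ M) powr (\<beta> / M) * 1 powr (1 - \<beta> / M) \<le> \<beta> / M * (r / R) ^ M + (1 - \<beta> / M) * 1"
    using M pos assms by (intro Youngs_inequality_0) auto
  moreover have "((r / R) ^ M) powr (\<beta> / M) = (r / R) powr \<beta>"
    using M pos by (simp add: powr_realpow[symmetric] powr_powr)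
  ultimately have "(r / R) powr \<beta> \<le> (1 - \<beta> / M) + \<beta> / M * (r / R) ^ M"
    by simp
  then have "R powr \<beta> * (r / R) powr \<beta> \<le> R powr \<beta> * ((1 - \<beta> / M) + \<beta> / M * (r / R) ^ M)"
    by (intro mult_left_mono) auto
  moreover have "R powr \<beta> * (r / R) powr \<beta> = r powr \<beta>"
    using assms False by (simp add: powr_mult[symmetric])
  ultimately show ?thesis by simp
qed

text \<open>
  The constant \<open>\<beta> ^ 3 * (2 * k + 3)\<close> is \<open>(f' r)\<^sup>2 * f'' r * r ^ 4 / (f r) ^ 3\<close> at \<open>r = norm y\<close>, for the radial
  profile \<open>f\<close> of the touching polynomial.
\<close>

lemma subsolution_touched_by_norm_powr:
  fixes u :: "real^'n::finite \<Rightarrow> real"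
  assumes sub: "viscosity_subsolution F u"
    and beta: "0 < \<beta>" "\<beta> \<le> 2 * real k + 4" and e: "0 \<le> \<epsilon>" and y: "y \<noteq> 0"
    and max: "\<And>x. u x - \<epsilon> * norm x powr \<beta> \<le> u y - \<epsilon> * norm y powr \<beta>"
  shows "F y (u y) \<le> \<beta> ^ 3 * (2 * real k + 3) * (\<epsilon> * norm y powr \<beta>) ^ 3 / norm y ^ 4"
proof -
  define R where "R = norm y"
  define A where "A = \<epsilon> * R powr \<beta>"
  define M where "M = 2 * Suc (Suc k)"
  define b where "b = A * (\<beta> / M) / R ^ M"
  define a where "a = A * (1 - \<beta> / M)"
  define \<phi> where "\<phi> = (\<lambda>x::real^'n. a + b * (x \<bullet> x) ^ Suc (Suc k))"
  have R: "R > 0" using y by (simp add: R_def)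
  have M: "real M = 2 * real k + 4" by (simp add: M_def)
  have \<phi>: "\<phi> x = A * ((1 - \<beta> / M) + \<beta> / M * (norm x / R) ^ M)" for x
  proof -
    have "(x \<bullet> x) ^ Suc (Suc k) = norm x ^ M"
      by (simp add: dot_square_norm M_def power_mult[symmetric] del: power_Suc mult_Suc_right)
    then show ?thesis
      unfolding \<phi>_def a_def b_def by (simp add: power_divide distrib_left del: power_Suc)
  qed
  have above: "\<epsilon> * norm x powr \<beta> \<le> \<phi> x" for x
    using mult_left_mono[OF powr_le_touching_monomial[of \<beta> M R "norm x"] e] beta R
    by (simp add: \<phi> A_def M mult.assoc)
  have "\<phi> y = \<epsilon> * norm y powr \<beta>"
    using R by (simp add: \<phi> A_def flip: R_def)
  with max above have "u x - \<phi> x \<le> u y - \<phi> y" for x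
    by (smt (verit))
  then have "\<forall>\<^sub>F x in nhds y. u x - \<phi> x \<le> u y - \<phi> y"
    by (rule always_eventually[OF allI])
  moreover have "C2 \<phi>"
    unfolding \<phi>_def by (rule C2_even_norm_power)
  ultimately have "F y (u y) \<le> infinity_laplacian \<phi> y"
    using sub unfolding viscosity_subsolution_def by blast
  also have "\<dots> = (2 * b * real (k + 2)) ^ 3 * real (2 * k + 3) * (y \<bullet> y) ^ (3 * k + 4)"
    unfolding \<phi>_def by (rule infinity_laplacian_even_norm_power)
  also have "2 * b * real (k + 2) = A * \<beta> / R ^ M"
  proof -
    have "real (k + 2) = real M / 2" unfolding M by simp
    moreover have "real M \<noteq> 0" by (simp add: M_def)
    ultimately show ?thesis unfolding b_def by (simp only:) simp
  qed
  also have "(y \<bullet> y) ^ (3 * k + 4) = R ^ (3 * M) / R ^ 4"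
  proof -
    have "3 * M = 2 * (3 * k + 4) + 4" by (simp add: M_def)
    then show ?thesis
      using R by (simp only: power_add dot_square_norm R_def power_mult) simp
  qed
  also have "(A * \<beta> / R ^ M) ^ 3 * real (2 * k + 3) * (R ^ (3 * M) / R ^ 4)
      = \<beta> ^ 3 * (2 * real k + 3) * A ^ 3 / R ^ 4"
    using R by (simp add: power_divide power_mult_distrib power_mult[symmetric] mult.commute[of 3])
  finally show ?thesis
    unfolding A_def R_def .
qed

text \<open>
  With \<open>\<beta> * (3 - m) = 4 + \<alpha>\<close>, dividing \<open>(\<epsilon> * R powr \<beta>) ^ 3 / R ^ 4\<close> by \<open>R powr \<alpha> * (\<epsilon> * R powr \<beta>) powr m\<close>
  cancels all powers of \<open>R\<close> and leaves \<open>\<epsilon> powr (3 - m)\<close>.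
\<close>

lemma henon_scaling:
  fixes R \<epsilon> \<alpha> m :: real
  assumes "R > 0" "\<epsilon> > 0" "\<beta> * (3 - m) = 4 + \<alpha>"
  shows "(\<epsilon> * R powr \<beta>) ^ 3 / R ^ 4 = \<epsilon> powr (3 - m) * (R powr \<alpha> * (\<epsilon> * R powr \<beta>) powr m)"
proof -
  define A where "A = \<epsilon> * R powr \<beta>"
  have A: "A > 0" using assms by (simp add: A_def)
  have "A ^ 3 = A powr (3 - m) * A powr m"
    using A by (simp add: powr_add[symmetric] powr_numeral)
  also have "A powr (3 - m) = \<epsilon> powr (3 - m) * R powr (4 + \<alpha>)"
    using assms by (simp add: A_def powr_mult powr_powr)
  also have "R powr (4 + \<alpha>) = R ^ 4 * R powr \<alpha>"
    using assms by (simp add: powr_add powr_numeral)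
  finally show ?thesis
    using assms by (simp add: A_def[symmetric])
qed

section \<open>Comparison and the Liouville property\<close>

lemma exists_maximum_if_nonpositive_near_infinity:
  fixes w :: "'a::euclidean_space \<Rightarrow> real"
  assumes cont: "continuous_on UNIV w" and inf: "\<forall>\<^sub>F x in at_infinity. w x \<le> 0" and z: "w z > 0"
  obtains y where "w y > 0" "\<And>x. w x \<le> w y"
proof -
  obtain B where B: "\<And>x. norm x \<ge> B \<Longrightarrow> w x \<le> 0"
    using inf by (auto simp: eventually_at_infinity)
  define K where "K = cball (0::'a) (max B (norm z))"
  have zK: "z \<in> K" by (simp add: K_def)
  have "compact K" by (simp add: K_def)
  then obtain y where y: "y \<in> K" "\<And>x. x \<in> K \<Longrightarrow> w x \<le> w y"
    using continuous_attains_sup[of K w] zK cont continuous_on_subset by blast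
  have pos: "w y > 0" using y(2)[OF zK] z by simp
  show ?thesis
  proof (rule that)
    show "w y > 0" by (rule pos)
    show "w x \<le> w y" for x
      using y(2)[of x] B[of x] pos by (cases "x \<in> K") (force simp: K_def)+
  qed
qed

lemma subsolution_le_norm_powr:
  fixes u :: "real^'n::finite \<Rightarrow> real"
  assumes m: "0 \<le> m" "m < 3"
    and beta: "0 < \<beta>" "\<beta> \<le> 2 * real k + 4" "\<beta> * (3 - m) = 4 + \<alpha>"
    and sub: "viscosity_subsolution (henon_rhs \<alpha> m) u"
    and u0: "u 0 = 0"
    and inf: "\<forall>\<^sub>F x in at_infinity. u x \<le> \<epsilon> * norm x powr \<beta>"
    and e: "0 < \<epsilon>" "\<beta> ^ 3 * (2 * real k + 3) * \<epsilon> powr (3 - m) < 1"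
  shows "u x \<le> \<epsilon> * norm x powr \<beta>"
proof (rule ccontr)
  assume "\<not> u x \<le> \<epsilon> * norm x powr \<beta>"
  define w where "w = (\<lambda>x. u x - \<epsilon> * norm x powr \<beta>)"
  have "continuous_on UNIV u"
    using sub by (simp add: viscosity_subsolution_def)
  then have "continuous_on UNIV w"
    unfolding w_def using beta(1) by (intro continuous_intros continuous_on_powr') auto
  moreover have "\<forall>\<^sub>F x in at_infinity. w x \<le> 0"
    using inf by (simp add: w_def)
  moreover have "w x > 0"
    using \<open>\<not> u x \<le> _\<close> by (simp add: w_def)
  ultimately obtain y where y: "w y > 0" "\<And>x. w x \<le> w y"
    using exists_maximum_if_nonpositive_near_infinity by metis
  have "y \<noteq> 0"
    using y(1) u0 by (auto simp: w_def)
  define R where "R = norm y"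
  define A where "A = \<epsilon> * R powr \<beta>"
  have R: "R > 0" using \<open>y \<noteq> 0\<close> by (simp add: R_def)
  have A: "A > 0" using e R by (simp add: A_def)
  have uy: "A < u y" using y(1) by (simp add: w_def A_def R_def)
  have "R powr \<alpha> * A powr m \<le> R powr \<alpha> * u y powr m"
    using A uy m by (intro mult_left_mono powr_mono2) auto
  also have "\<dots> = henon_rhs \<alpha> m y (u y)"
    using R A uy by (simp add: henon_rhs_def real_power_def R_def)
  also have "\<dots> \<le> \<beta> ^ 3 * (2 * real k + 3) * A ^ 3 / R ^ 4"
    unfolding A_def R_def
    by (rule subsolution_touched_by_norm_powr[OF sub beta(1,2) less_imp_le[OF e(1)] \<open>y \<noteq> 0\<close>])
       (use y(2) in \<open>simp add: w_def\<close>)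
  also have "\<dots> = \<beta> ^ 3 * (2 * real k + 3) * \<epsilon> powr (3 - m) * (R powr \<alpha> * A powr m)"
    unfolding A_def times_divide_eq_right[symmetric] henon_scaling[OF R e(1) beta(3)]
    by (simp only: mult.assoc)
  also have "\<dots> < 1 * (R powr \<alpha> * A powr m)"
    using e(2) R A by (intro mult_strict_right_mono) auto
  finally show False by simp
qed

theorem theorem3:
  fixes u :: "real^'n::finite \<Rightarrow> real" and m \<alpha> :: real
  assumes "CARD('n) \<ge> 2"
    and "0 \<le> m" and "m < 3"
    and "\<alpha> > - (4 / 3) * m"
    and "viscosity_solution (henon_rhs \<alpha> m) u"
    and "\<And>x. u x \<ge> 0"
    and "u 0 = 0"
    and "((\<lambda>x. u x / norm x powr ((4 + \<alpha>) / (3 - m))) \<longlongrightarrow> 0) at_infinity"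
  shows "\<forall>x. u x = 0"
proof
  fix x
  define \<beta> where "\<beta> = (4 + \<alpha>) / (3 - m)"
  have beta: "\<beta> > 0" "\<beta> * (3 - m) = 4 + \<alpha>"
    using assms(2,3,4) by (auto simp: \<beta>_def)
  obtain k :: nat where "\<beta> \<le> real k"
    using real_arch_simple by blast
  then have k: "\<beta> \<le> 2 * real k + 4" by simp
  have sub: "viscosity_subsolution (henon_rhs \<alpha> m) u"
    using assms(5) by (simp add: viscosity_solution_def)
  have infinity: "\<forall>\<^sub>F x in at_infinity. u x \<le> \<epsilon> * norm x powr \<beta>" if "\<epsilon> > 0" for \<epsilon>
  proof -
    have "\<forall>\<^sub>F x in at_infinity. u x / norm x powr \<beta> < \<epsilon>"
      using order_tendstoD(2)[OF assms(8) that] by (simp add: \<beta>_def)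
    moreover have "\<forall>\<^sub>F x::real^'n in at_infinity. norm x > 0"
      by (auto simp: eventually_at_infinity intro: exI[of _ 1])
    ultimately show ?thesis
      by eventually_elim (simp add: field_simps)
  qed
  have "((\<lambda>\<epsilon>. \<beta> ^ 3 * (2 * real k + 3) * \<epsilon> powr (3 - m)) \<longlongrightarrow> \<beta> ^ 3 * (2 * real k + 3) * 0 powr (3 - m))
      (at_right 0)"
    using assms(3)
    by (intro tendsto_intros tendsto_powr2) (auto simp: eventually_at_filter)
  then have "\<forall>\<^sub>F \<epsilon> in at_right 0. \<beta> ^ 3 * (2 * real k + 3) * \<epsilon> powr (3 - m) < 1"
    by (rule order_tendstoD(2)) simp
  moreover have "\<forall>\<^sub>F \<epsilon>::real in at_right 0. \<epsilon> > 0"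
    by (rule eventually_at_right_less)
  ultimately have "\<forall>\<^sub>F \<epsilon> in at_right 0. u x \<le> \<epsilon> * norm x powr \<beta>"
    by eventually_elim
       (rule subsolution_le_norm_powr[OF assms(2,3) beta(1) k beta(2) sub assms(7) infinity])
  moreover have "((\<lambda>\<epsilon>. \<epsilon> * norm x powr \<beta>) \<longlongrightarrow> 0 * norm x powr \<beta>) (at_right 0)"
    by (intro tendsto_intros)
  ultimately have "u x \<le> 0 * norm x powr \<beta>"
    using tendsto_lowerbound by (metis trivial_limit_at_right_real)
  then show "u x = 0"
    using assms(6)[of x] by simp
qed

end
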